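(* Let $H$ be a separable Hilbert space with a fixed orthonormal basis $\{e_n\}_{n\in\mathbb N}$. The $C^*$-algebra $\mathbb B_f(H)$ has no polar decomposition, i.e. there exists $a\in\mathbb B_f(H)$ for which there is no partial isometry $w\in\mathbb B_f(H)$ with $a=w(a^*a)^{1/2}$ and $\ker w=\ker a$. Hence $\mathbb B_f(H)$ is not an $AW^*$-algebra.
   Context: For a Hilbert space $H$ with fixed orthonormal basis $\{e_n\}_{n\in\mathbb N}$, $\mathbb B(H)$ denotes the bounded operators, and operators are identified with their matrices with respect to this basis. For $k\in\mathbb N$, $\mathbb B^{(k)}(H)$ is the set of all $a\in\mathbb B(H)$ whose matrix has no more than $k$ non-zero entries in each line (row) and no more than $k$ non-zero entries in each column. $\mathbb B^{(\infty)}(H)=\bigcup_{k\in\mathbb N}\mathbb B^{(k)}(H)$, and $\mathbb B_f(H)$ is the operator-norm closure of $\mathbb B^{(\infty)}(H)$ in $\mathbb B(H)$; it is a unital $C^*$-subalgebra of $\mathbb B(H)$. An $AW^*$-algebra is a $C^*$-algebra $A$ such that for every subset $S\subset A$ the right annihilator $\{x\in A: sx=0\ \text{for all } s\in S\}$ is of the form $qA$ for some projection $q\in A$. *)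

theory Defs
  imports "HOL-Analysis.Analysis"
begin

text \<open>
  Complex Hilbert spaces. The inner product is linear in the first argument. Positivity and
  definiteness of the inner product are contained in \<open>cinner_self\<close>, since the norm is one already;
  \<open>1 *\<^sub>C x = x\<close> is contained in \<open>scaleR_scaleC\<close>.
\<close>

class complex_inner = real_normed_vector +
  fixes scaleC :: "complex \<Rightarrow> 'a \<Rightarrow> 'a"  (infixr "*\<^sub>C" 75)
    and cinner :: "'a \<Rightarrow> 'a \<Rightarrow> complex"
  assumes scaleC_add_right: "c *\<^sub>C (x + y) = c *\<^sub>C x + c *\<^sub>C y"
    and scaleC_add_left: "(c + d) *\<^sub>C x = c *\<^sub>C x + d *\<^sub>C x"
    and scaleC_scaleC: "c *\<^sub>C d *\<^sub>C x = (c * d) *\<^sub>C x"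
    and scaleR_scaleC: "r *\<^sub>R x = complex_of_real r *\<^sub>C x"
    and cinner_commute: "cinner x y = cnj (cinner y x)"
    and cinner_add_left: "cinner (x + y) z = cinner x z + cinner y z"
    and cinner_scaleC_left: "cinner (c *\<^sub>C x) y = c * cinner x y"
    and cinner_self: "cinner x x = complex_of_real ((norm x)\<^sup>2)"

class complex_hilbert = complex_inner + banach

definition orthonormal_basis :: "(nat \<Rightarrow> 'a::complex_inner) \<Rightarrow> bool" where
  "orthonormal_basis e \<longleftrightarrow>
     (\<forall>m n. cinner (e m) (e n) = (if m = n then 1 else 0)) \<and>
     closure (module.span scaleC (range e)) = UNIV"

lemma norm_scaleC: "norm (c *\<^sub>C (x::'a::complex_inner)) = cmod c * norm x"
proof -
  have "complex_of_real ((norm (c *\<^sub>C x))\<^sup>2) = c * cnj c * cinner x x"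
    unfolding cinner_self[symmetric]
    by (metis cinner_commute cinner_scaleC_left complex_cnj_mult mult.assoc)
  also have "\<dots> = complex_of_real ((cmod c * norm x)\<^sup>2)"
    unfolding cinner_self by (simp add: complex_norm_square[symmetric] power_mult_distrib)
  finally have "(norm (c *\<^sub>C x))\<^sup>2 = (cmod c * norm x)\<^sup>2"
    using of_real_eq_iff by blast
  then show ?thesis
    by (simp add: power2_eq_iff_nonneg)
qed

text \<open>
  Elements of the library type \<open>'a \<Rightarrow>\<^sub>L 'a\<close> are the bounded \<^emph>\<open>real\<close>-linear maps, with the operator
  norm; \<open>BH\<close> consists of the complex-linear ones.
\<close>

definition BH :: "('a::complex_inner \<Rightarrow>\<^sub>L 'a) set" where
  "BH = {a. \<forall>c x. blinfun_apply a (c *\<^sub>C x) = c *\<^sub>C blinfun_apply a x}"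

lift_definition scaleC_op :: "complex \<Rightarrow> ('a::complex_inner \<Rightarrow>\<^sub>L 'a) \<Rightarrow> ('a \<Rightarrow>\<^sub>L 'a)"
  is "\<lambda>c a x. c *\<^sub>C a x"
proof -
  fix c :: complex and a :: "'a \<Rightarrow> 'a"
  assume "bounded_linear a"
  moreover have "bounded_linear (\<lambda>x::'a. c *\<^sub>C x)"
    by (rule bounded_linear_intro[where K = "cmod c"])
      (simp_all add: scaleC_add_right scaleR_scaleC scaleC_scaleC norm_scaleC mult.commute)
  ultimately show "bounded_linear (\<lambda>x. c *\<^sub>C a x)"
    by (rule bounded_linear_compose[rotated])
qed

text \<open>For \<open>a \<in> BH\<close> on a Hilbert space there is exactly one such \<open>b\<close>, and it lies in \<open>BH\<close>.\<close>

definition adj :: "('a::complex_hilbert \<Rightarrow>\<^sub>L 'a) \<Rightarrow> ('a \<Rightarrow>\<^sub>L 'a)" where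
  "adj a = (THE b. \<forall>x y. cinner (blinfun_apply a x) y = cinner x (blinfun_apply b y))"

definition positive_op :: "('a::complex_inner \<Rightarrow>\<^sub>L 'a) \<Rightarrow> bool" where
  "positive_op p \<longleftrightarrow>
     p \<in> BH \<and> (\<forall>x. cinner (blinfun_apply p x) x \<in> \<real> \<and> Re (cinner (blinfun_apply p x) x) \<ge> 0)"

text \<open>For positive \<open>b\<close> on a Hilbert space there is exactly one such \<open>p\<close>.\<close>

definition sqrt_op :: "('a::complex_hilbert \<Rightarrow>\<^sub>L 'a) \<Rightarrow> ('a \<Rightarrow>\<^sub>L 'a)" where
  "sqrt_op b = (THE p. positive_op p \<and> p o\<^sub>L p = b)"

definition projection :: "('a::complex_hilbert \<Rightarrow>\<^sub>L 'a) \<Rightarrow> bool" where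
  "projection q \<longleftrightarrow> q \<in> BH \<and> adj q = q \<and> q o\<^sub>L q = q"

definition partial_isometry :: "('a::complex_hilbert \<Rightarrow>\<^sub>L 'a) \<Rightarrow> bool" where
  "partial_isometry w \<longleftrightarrow> w \<in> BH \<and> projection (adj w o\<^sub>L w)"

definition ker_op :: "('a::complex_inner \<Rightarrow>\<^sub>L 'a) \<Rightarrow> 'a set" where
  "ker_op a = {x. blinfun_apply a x = 0}"

definition mat_entry ::
    "(nat \<Rightarrow> 'a::complex_inner) \<Rightarrow> ('a \<Rightarrow>\<^sub>L 'a) \<Rightarrow> nat \<Rightarrow> nat \<Rightarrow> complex" where
  "mat_entry e a i j = cinner (blinfun_apply a (e j)) (e i)"

text \<open>Finiteness is required explicitly because \<open>card\<close> of an infinite set is \<open>0\<close>.\<close>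

definition B_k :: "(nat \<Rightarrow> 'a::complex_inner) \<Rightarrow> nat \<Rightarrow> ('a \<Rightarrow>\<^sub>L 'a) set" where
  "B_k e k = {a \<in> BH.
     (\<forall>i. finite {j. mat_entry e a i j \<noteq> 0} \<and> card {j. mat_entry e a i j \<noteq> 0} \<le> k) \<and>
     (\<forall>j. finite {i. mat_entry e a i j \<noteq> 0} \<and> card {i. mat_entry e a i j \<noteq> 0} \<le> k)}"

definition B_inf :: "(nat \<Rightarrow> 'a::complex_inner) \<Rightarrow> ('a \<Rightarrow>\<^sub>L 'a) set" where
  "B_inf e = (\<Union>k. B_k e k)"

text \<open>The closure is the same as in \<open>BH\<close>, because \<open>BH\<close> is norm-closed.\<close>

definition B_f :: "(nat \<Rightarrow> 'a::complex_inner) \<Rightarrow> ('a \<Rightarrow>\<^sub>L 'a) set" where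
  "B_f e = closure (B_inf e)"

definition cstar_subalgebra :: "('a::complex_hilbert \<Rightarrow>\<^sub>L 'a) set \<Rightarrow> bool" where
  "cstar_subalgebra A \<longleftrightarrow>
     A \<subseteq> BH \<and> 0 \<in> A \<and> closed A \<and>
     (\<forall>a\<in>A. \<forall>b\<in>A. a + b \<in> A \<and> a o\<^sub>L b \<in> A) \<and>
     (\<forall>a\<in>A. adj a \<in> A \<and> (\<forall>c. scaleC_op c a \<in> A))"

definition AW_star_algebra :: "('a::complex_hilbert \<Rightarrow>\<^sub>L 'a) set \<Rightarrow> bool" where
  "AW_star_algebra A \<longleftrightarrow>
     cstar_subalgebra A \<and>
     (\<forall>S\<subseteq>A. \<exists>q\<in>A. projection q \<and> {x \<in> A. \<forall>s\<in>S. s o\<^sub>L x = 0} = (\<lambda>x. q o\<^sub>L x) ` A)"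

end

(* Let v_n be the sum of one basis vector and of (n + 1)^2 further ones with weight 1 / (n + 1), all
   basis vectors being distinct. The projection P onto the closed span of the orthogonal sequence v_n
   maps the first of these basis vectors to v_n / 2, a vector with half of its mass spread evenly over
   many coordinates, whereas the columns of an operator in B_f are uniformly close to k-sparse
   vectors. So P is not in B_f. It is the partial isometry in the polar decomposition of the positive
   operator sum_n 2^(-n-1) <., v_n> v_n, which is a norm limit of finite matrices, and it would
   generate the right annihilator of {s in B_f. s v_n = 0 for all n}. *)

theory Submission
  imports Defs
begin

section \<open>Complex inner product spaces\<close>

lemma cinner_add_right: "cinner x (y + z) = cinner x y + cinner x z"
  for x :: "'a::complex_inner"
  by (metis cinner_add_left cinner_commute complex_cnj_add)

lemma cinner_scaleC_right: "cinner x (c *\<^sub>C y) = cnj c * cinner x y"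
  for x :: "'a::complex_inner"
  by (metis cinner_scaleC_left cinner_commute complex_cnj_mult)

lemma scaleC_one: "1 *\<^sub>C x = x" for x :: "'a::complex_inner"
  by (metis of_real_1 scaleR_one scaleR_scaleC)

lemma module_scaleC: "module (scaleC :: complex \<Rightarrow> 'a \<Rightarrow> 'a::complex_inner)"
  by unfold_locales (simp_all add: scaleC_add_right scaleC_add_left scaleC_scaleC scaleC_one)

text \<open>Provides \<open>scaleC.span\<close>, the span that occurs in
  \<open>orthonormal_basis\<close>, together with its minimality among subspaces.\<close>

interpretation scaleC: module "scaleC :: complex \<Rightarrow> 'a \<Rightarrow> 'a::complex_inner"
  by (rule module_scaleC)

lemma cinner_scaleR_left: "cinner (r *\<^sub>R x) y = r *\<^sub>R cinner x y"
  for x :: "'a::complex_inner"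
  by (simp add: scaleR_scaleC cinner_scaleC_left scaleR_conv_of_real)

lemma cinner_scaleR_right: "cinner x (r *\<^sub>R y) = r *\<^sub>R cinner x y"
  for x :: "'a::complex_inner"
  by (simp add: scaleR_scaleC cinner_scaleC_right scaleR_conv_of_real)

lemma Re_cinner_self: "Re (cinner x x) = (norm x)\<^sup>2"
  by (simp add: cinner_self)

lemma cinner_zero_left: "cinner 0 y = 0" for y :: "'a::complex_inner"
  using cinner_scaleC_left[of 0 0 y] by simp

lemma cinner_diff_left: "cinner (x - y) z = cinner x z - cinner y z"
  for x :: "'a::complex_inner"
  by (metis add_diff_cancel_right' cinner_add_left diff_add_cancel)

text \<open>Cauchy-Schwarz by Pythagoras: \<open>x\<close> splits into its component
  \<open>c *\<^sub>C y\<close> along \<open>y\<close> and an orthogonal remainder, so that component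
  is no longer than \<open>x\<close>.\<close>

lemma norm_cinner_le: "norm (cinner x y) \<le> norm x * norm y"
  for x :: "'a::complex_inner"
proof (cases "y = 0")
  case True
  then show ?thesis
    by (metis cinner_commute cinner_zero_left complex_cnj_zero mult_zero_right norm_zero order_refl)
next
  case False
  define c where "c = cinner x y / complex_of_real ((norm y)\<^sup>2)"
  have cy: "c * complex_of_real ((norm y)\<^sup>2) = cinner x y"
    using False by (simp add: c_def)
  have "cinner (x - c *\<^sub>C y) y = 0"
    by (simp add: cinner_diff_left cinner_scaleC_left cinner_self cy del: of_real_power)
  then have "cinner (x - c *\<^sub>C y) (c *\<^sub>C y) = 0"
    by (simp add: cinner_scaleC_right)
  then have "cinner (c *\<^sub>C y) (x - c *\<^sub>C y) = 0"
    by (metis cinner_commute complex_cnj_zero)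
  with \<open>cinner (x - c *\<^sub>C y) (c *\<^sub>C y) = 0\<close>
  have "cinner ((x - c *\<^sub>C y) + c *\<^sub>C y) ((x - c *\<^sub>C y) + c *\<^sub>C y)
      = cinner (x - c *\<^sub>C y) (x - c *\<^sub>C y) + cinner (c *\<^sub>C y) (c *\<^sub>C y)"
    by (simp only: cinner_add_left cinner_add_right) simp
  then have "(norm x)\<^sup>2 = (norm (x - c *\<^sub>C y))\<^sup>2 + (norm (c *\<^sub>C y))\<^sup>2"
    by (simp add: cinner_self of_real_add[symmetric] del: of_real_power of_real_add)
  then have "norm (c *\<^sub>C y) \<le> norm x"
    using power2_le_imp_le[of "norm (c *\<^sub>C y)" "norm x"] by simp
  moreover have "norm (c *\<^sub>C y) = norm (cinner x y) / norm y"
    using False by (simp add: norm_scaleC c_def norm_divide norm_mult power2_eq_square)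
  ultimately show ?thesis
    using False by (simp add: divide_simps)
qed

lemma bounded_bilinear_cinner:
  "bounded_bilinear (cinner :: 'a \<Rightarrow> 'a \<Rightarrow> complex)" for dummy :: "'a::complex_inner"
  by (intro bounded_bilinear.intro exI[of _ 1] allI)
    (simp_all add: cinner_add_left cinner_add_right cinner_scaleR_left cinner_scaleR_right norm_cinner_le)

interpretation cinner: bounded_bilinear "cinner :: 'a \<Rightarrow> 'a \<Rightarrow> complex" for dummy :: "'a::complex_inner"
  by (rule bounded_bilinear_cinner)

lemma cinner_eq_zero_commute: "cinner x y = 0 \<longleftrightarrow> cinner y x = 0"
  by (metis cinner_commute complex_cnj_zero)

lemma cinner_right_eqI: "(\<And>x. cinner x y = cinner x z) \<Longrightarrow> y = z" for y :: "'a::complex_inner"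
proof -
  assume "\<And>x. cinner x y = cinner x z"
  then have "cinner (y - z) (y - z) = 0"
    by (simp add: cinner.diff_right)
  then show "y = z"
    by (simp add: cinner_self)
qed

lemma bounded_linear_scaleC: "bounded_linear (\<lambda>x::'a::complex_inner. c *\<^sub>C x)"
  by (rule bounded_linear_intro[where K = "cmod c"])
    (simp_all add: scaleC_add_right scaleR_scaleC scaleC_scaleC norm_scaleC mult.commute)


section \<open>Complex-linear operators\<close>

lemma BH_scaleC: "a \<in> BH \<Longrightarrow> blinfun_apply a (c *\<^sub>C x) = c *\<^sub>C blinfun_apply a x"
  by (simp add: BH_def)

lemma BH_zero: "0 \<in> BH"
  by (simp add: BH_def)

lemma BH_id: "id_blinfun \<in> BH"
  by (simp add: BH_def)

lemma BH_add: "a \<in> BH \<Longrightarrow> b \<in> BH \<Longrightarrow> a + b \<in> BH"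
  by (simp add: BH_def blinfun.add_left scaleC_add_right)

lemma BH_diff: "a \<in> BH \<Longrightarrow> b \<in> BH \<Longrightarrow> a - b \<in> BH"
  by (simp add: BH_def blinfun.diff_left scaleC.scale_right_diff_distrib)

lemma BH_compose: "a \<in> BH \<Longrightarrow> b \<in> BH \<Longrightarrow> a o\<^sub>L b \<in> BH"
  by (simp add: BH_def)

lemma BH_scaleC_op: "a \<in> BH \<Longrightarrow> scaleC_op c a \<in> BH"
  by (simp add: BH_def scaleC_op.rep_eq mult.commute)

text \<open>For fixed \<open>c\<close> and \<open>x\<close>, both sides of the linearity condition
  depend continuously on \<open>a\<close>. Norm limits of sparse matrices therefore stay
  complex-linear.\<close>

lemma closed_BH: "closed (BH :: ('a::complex_inner \<Rightarrow>\<^sub>L 'a) set)"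
proof -
  have "(BH :: ('a \<Rightarrow>\<^sub>L 'a) set) = (\<Inter>c. \<Inter>x. {a. blinfun_apply a (c *\<^sub>C x) = c *\<^sub>C blinfun_apply a (x::'a)})"
    by (auto simp: BH_def)
  also have "closed \<dots>"
    by (intro closed_INT ballI closed_Collect_eq bounded_linear.continuous_on[OF bounded_linear_scaleC]
        continuous_intros)
  finally show ?thesis .
qed

section \<open>Rank-one operators and uniqueness of adjoints\<close>

lift_definition rank_one :: "'a::complex_inner \<Rightarrow> 'a \<Rightarrow> ('a \<Rightarrow>\<^sub>L 'a)"
  is "\<lambda>u v z. cinner z v *\<^sub>C u"
proof (rule bounded_linear_intro)
  fix u v x :: 'a
  show "norm (cinner x v *\<^sub>C u) \<le> norm x * (norm v * norm u)"
    by (simp add: norm_scaleC mult_right_mono norm_cinner_le flip: mult.assoc)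
qed (simp_all add: cinner_add_left scaleC_add_left cinner_scaleC_left scaleC_scaleC scaleR_scaleC)

lemma norm_rank_one: "norm (rank_one u v) \<le> norm u * norm v"
proof (rule norm_blinfun_bound)
  fix x
  have "norm (cinner x v) * norm u \<le> (norm x * norm v) * norm u"
    by (intro mult_right_mono norm_cinner_le norm_ge_zero)
  then show "norm (blinfun_apply (rank_one u v) x) \<le> norm u * norm v * norm x"
    by (simp add: rank_one.rep_eq norm_scaleC mult_ac)
qed simp

lemma BH_rank_one: "rank_one u v \<in> BH"
  by (simp add: BH_def rank_one.rep_eq cinner_scaleC_left)

text \<open>As \<open>adj\<close> is a definite description, a witness \<open>b\<close> is enough
  once uniqueness is known, and definiteness of the inner product supplies that.\<close>

lemma adj_eqI:
  assumes "\<And>x y. cinner (blinfun_apply a x) y = cinner x (blinfun_apply b y)"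
  shows "adj a = b"
  unfolding adj_def
proof (rule the_equality)
  show "\<forall>x y. cinner (blinfun_apply a x) y = cinner x (blinfun_apply b y)"
    using assms by simp
next
  fix c assume "\<forall>x y. cinner (blinfun_apply a x) y = cinner x (blinfun_apply c y)"
  then show "c = b"
    using assms by (intro blinfun_eqI cinner_right_eqI) metis
qed

section \<open>Positive operators: kernels and eigenvectors\<close>

text \<open>Since \<open>\<langle>p (x + t p x), x + t p x\<rangle> = \<langle>p x, x\<rangle> + t \<parallel>p x\<parallel>\<^sup>2\<close> is nonnegative for all real \<open>t\<close>,
  \<open>p x\<close> vanishes.\<close>

lemma positive_op_kernel:
  assumes "positive_op p" and "blinfun_apply p (blinfun_apply p x) = 0"
  shows "blinfun_apply p x = 0"
proof (rule ccontr)
  define u where "u = blinfun_apply p x"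
  assume "blinfun_apply p x \<noteq> 0"
  then have u: "norm u > 0"
    by (simp add: u_def)
  define t where "t = - (Re (cinner u x) + 1) / (norm u)\<^sup>2"
  have "blinfun_apply p (x + t *\<^sub>R u) = u"
    using assms(2) by (simp add: u_def blinfun.add_right blinfun.scaleR_right)
  then have "0 \<le> Re (cinner u (x + t *\<^sub>R u))"
    using assms(1) by (metis positive_op_def)
  also have "\<dots> = Re (cinner u x) + t * (norm u)\<^sup>2"
    by (simp add: cinner_add_right cinner_scaleR_right cinner_self del: of_real_power)
  also have "\<dots> = - 1"
    using u by (simp add: t_def)
  finally show False
    by simp
qed

text \<open>Here \<open>y = p x - c x\<close> satisfies \<open>p y = - c y\<close>, which positivity only allows for \<open>y = 0\<close>.\<close>

lemma positive_op_eigenvector: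
  assumes "positive_op p" and "blinfun_apply p (blinfun_apply p x) = c\<^sup>2 *\<^sub>R x" and "c > 0"
  shows "blinfun_apply p x = c *\<^sub>R x"
proof -
  define y where "y = blinfun_apply p x - c *\<^sub>R x"
  have "blinfun_apply p y = - c *\<^sub>R y"
    using assms(2)
    by (simp add: y_def blinfun.diff_right blinfun.scaleR_right power2_eq_square algebra_simps)
  then have "Re (cinner (blinfun_apply p y) y) = - c * (norm y)\<^sup>2"
    by (simp add: cinner_scaleR_left cinner.minus_left cinner_self del: of_real_power)
  moreover have "0 \<le> Re (cinner (blinfun_apply p y) y)"
    using assms(1) by (simp add: positive_op_def)
  ultimately have "c * (norm y)\<^sup>2 \<le> 0"
    by simp
  then have "y = 0"
    using assms(3) by (simp add: mult_le_0_iff)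
  then show ?thesis
    by (simp add: y_def)
qed


section \<open>Orthonormal bases and adjoints\<close>

locale hilbert_basis =
  fixes e :: "nat \<Rightarrow> 'a::complex_hilbert"
  assumes onb: "orthonormal_basis e"
begin

lemma cinner_basis: "cinner (e m) (e n) = (if m = n then 1 else 0)"
  using onb by (simp add: orthonormal_basis_def)

text \<open>The vectors satisfying \<open>P\<close> form a closed complex subspace that contains the
  basis. Continuous identities that are linear or antilinear in \<open>x\<close> can thus be checked
  on basis vectors.\<close>

lemma basis_induct:
  assumes cl: "closed {x. P x}" and z: "P 0" and add: "\<And>x y. P x \<Longrightarrow> P y \<Longrightarrow> P (x + y)"
    and sc: "\<And>c x. P x \<Longrightarrow> P (c *\<^sub>C x)" and e: "\<And>n. P (e n)"
  shows "P x"
proof -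
  have "scaleC.span (range e) \<subseteq> {x. P x}"
    by (rule scaleC.span_minimal) (use e z add sc in \<open>auto simp: scaleC.subspace_def\<close>)
  then have "closure (scaleC.span (range e)) \<subseteq> {x. P x}"
    by (rule closure_minimal[OF _ cl])
  then show ?thesis
    using onb by (auto simp: orthonormal_basis_def)
qed

lemma BH_eqI:
  assumes "a \<in> BH" "b \<in> BH" "\<And>n. blinfun_apply a (e n) = blinfun_apply b (e n)"
  shows "a = b"
proof (rule blinfun_eqI)
  fix x show "blinfun_apply a x = blinfun_apply b x"
    by (induction x rule: basis_induct)
      (use assms in \<open>auto simp: blinfun.add_right BH_scaleC intro!: closed_Collect_eq continuous_intros\<close>)
qed

lemma orthogonal_basis_zero:
  assumes "\<And>n. cinner x (e n) = 0"
  shows "x = 0"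
proof -
  have "cinner x y = 0" for y
    by (induction y rule: basis_induct)
      (use assms in \<open>auto simp: cinner_add_right cinner_scaleC_right cinner.zero_right
         intro!: closed_Collect_eq cinner.continuous_on continuous_intros\<close>)
  then have "cinner x x = 0" .
  then show ?thesis
    by (simp add: cinner_self)
qed

section \<open>Finite expansions, Bessel's inequality and the existence of adjoints\<close>

lemma cinner_sum_basis:
  assumes "finite F"
  shows "cinner (\<Sum>i\<in>F. c i *\<^sub>C e i) (e j) = (if j \<in> F then c j else 0)"
  using assms by (simp add: cinner.sum_left cinner_scaleC_left cinner_basis sum.If_cases if_distrib cong: if_cong)

lemma norm_sum_basis:
  assumes "finite F"
  shows "(norm (\<Sum>i\<in>F. c i *\<^sub>C e i))\<^sup>2 = (\<Sum>i\<in>F. (cmod (c i))\<^sup>2)"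
proof -
  have "cinner (\<Sum>i\<in>F. c i *\<^sub>C e i) (\<Sum>i\<in>F. c i *\<^sub>C e i) = (\<Sum>j\<in>F. cnj (c j) * c j)"
    by (subst cinner.sum_right) (simp add: cinner_scaleC_right cinner_sum_basis assms)
  then have "complex_of_real ((norm (\<Sum>i\<in>F. c i *\<^sub>C e i))\<^sup>2) = complex_of_real (\<Sum>i\<in>F. (cmod (c i))\<^sup>2)"
    by (simp add: cinner_self complex_norm_square mult.commute del: of_real_power)
  then show ?thesis
    using of_real_eq_iff by blast
qed

lemma finite_expansion:
  assumes "finite F" "\<And>i. i \<notin> F \<Longrightarrow> cinner x (e i) = 0"
  shows "x = (\<Sum>i\<in>F. cinner x (e i) *\<^sub>C e i)"
proof -
  have "x - (\<Sum>i\<in>F. cinner x (e i) *\<^sub>C e i) = 0"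
    by (rule orthogonal_basis_zero) (use assms in \<open>auto simp: cinner_diff_left cinner_sum_basis\<close>)
  then show ?thesis
    by simp
qed

text \<open>For the partial expansion \<open>s\<close> of \<open>x\<close>,
  \<open>cinner x s\<close> equals the squared norm of \<open>s\<close>; by Cauchy-Schwarz,
  \<open>s\<close> is then no longer than \<open>x\<close>.\<close>

lemma bessel:
  assumes "finite F"
  shows "(\<Sum>i\<in>F. (cmod (cinner x (e i)))\<^sup>2) \<le> (norm x)\<^sup>2"
proof -
  define s where "s = (\<Sum>i\<in>F. cinner x (e i) *\<^sub>C e i)"
  have ns: "(norm s)\<^sup>2 = (\<Sum>i\<in>F. (cmod (cinner x (e i)))\<^sup>2)"
    unfolding s_def by (rule norm_sum_basis[OF assms])
  have "cinner x s = (\<Sum>i\<in>F. cnj (cinner x (e i)) * cinner x (e i))"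
    by (simp add: s_def cinner.sum_right cinner_scaleC_right)
  also have "\<dots> = complex_of_real ((norm s)\<^sup>2)"
    by (simp add: ns complex_norm_square mult.commute del: of_real_power)
  finally have "(norm s)\<^sup>2 \<le> norm x * norm s"
    using norm_cinner_le[of x s] by (simp add: norm_power)
  then have "norm s \<le> norm x"
    by (cases "s = 0") (simp_all add: power2_eq_square)
  then have "(norm s)\<^sup>2 \<le> (norm x)\<^sup>2"
    by (intro power_mono) auto
  then show ?thesis
    by (simp add: ns)
qed

text \<open>Riesz representation of the functional sending \<open>x\<close> to
  \<open>cinner (a x) y\<close>. Inserting \<open>x = e i\<close> forces the coefficients of
  \<open>z\<close> to be \<open>c i\<close>; what has to be shown is that their series
  converges.\<close>

lemma adjoint_vector:
  fixes a :: "'a \<Rightarrow>\<^sub>L 'a"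
  assumes a: "a \<in> BH"
  shows "\<exists>z. \<forall>x. cinner (blinfun_apply a x) y = cinner x z"
proof -
  define c where "c i = cinner y (blinfun_apply a (e i))" for i
  define K where "K = norm y * norm a"
  \<comment> \<open>Pairing \<open>y\<close> with \<open>a s\<close> for a finite sum
    \<open>s\<close> reproduces the squared norm of \<open>s\<close>, and boundedness of
    \<open>a\<close> turns this into \<open>norm s \<le> K\<close>.\<close>
  have bound: "(\<Sum>i\<in>F. (cmod (c i))\<^sup>2) \<le> K\<^sup>2" if F: "finite F" for F
  proof -
    define s where "s = (\<Sum>i\<in>F. c i *\<^sub>C e i)"
    have ns: "(norm s)\<^sup>2 = (\<Sum>i\<in>F. (cmod (c i))\<^sup>2)"
      unfolding s_def by (rule norm_sum_basis[OF F])
    have "cinner y (blinfun_apply a s) = (\<Sum>i\<in>F. cnj (c i) * c i)"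
      by (simp add: s_def blinfun.sum_right BH_scaleC[OF a] cinner.sum_right cinner_scaleC_right
          c_def[symmetric])
    also have "\<dots> = complex_of_real ((norm s)\<^sup>2)"
      by (simp add: ns complex_norm_square mult.commute del: of_real_power)
    finally have "(norm s)\<^sup>2 = cmod (cinner y (blinfun_apply a s))"
      by (simp add: norm_power)
    also have "\<dots> \<le> norm y * norm (blinfun_apply a s)"
      by (rule norm_cinner_le)
    also have "\<dots> \<le> K * norm s"
      unfolding K_def mult.assoc by (intro mult_left_mono norm_blinfun norm_ge_zero)
    finally have "norm s \<le> K"
      by (cases "s = 0") (simp_all add: power2_eq_square K_def)
    then have "(norm s)\<^sup>2 \<le> K\<^sup>2"
      by (intro power_mono) auto
    then show ?thesis
      by (simp add: ns)
  qed
  have sq: "summable (\<lambda>i. (cmod (c i))\<^sup>2)"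
    by (rule summableI_nonneg_bounded[of _ "K\<^sup>2"]) (simp_all add: bound)
  \<comment> \<open>Completeness of the space enters here: by orthonormality, the Cauchy condition
    for the vectors reduces to the one for the squared coefficients.\<close>
  have "summable (\<lambda>i. c i *\<^sub>C e i)"
    unfolding summable_Cauchy
  proof (intro allI impI)
    fix \<epsilon> :: real assume "\<epsilon> > 0"
    then obtain N where N: "\<And>m n. m \<ge> N \<Longrightarrow> norm (\<Sum>i=m..<n. (cmod (c i))\<^sup>2) < \<epsilon>\<^sup>2"
      using sq unfolding summable_Cauchy by (metis zero_less_power)
    have "norm (\<Sum>i=m..<n. c i *\<^sub>C e i) < \<epsilon>" if "m \<ge> N" for m n
    proof (rule power2_less_imp_less)
      show "(norm (\<Sum>i=m..<n. c i *\<^sub>C e i))\<^sup>2 < \<epsilon>\<^sup>2"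
        using N[OF that, of n] by (simp add: norm_sum_basis)
    qed (use \<open>\<epsilon> > 0\<close> in simp)
    then show "\<exists>N. \<forall>m\<ge>N. \<forall>n. norm (\<Sum>i=m..<n. c i *\<^sub>C e i) < \<epsilon>"
      by blast
  qed
  then obtain z where z: "(\<lambda>i. c i *\<^sub>C e i) sums z"
    by (auto simp: summable_def)
  have "cinner (blinfun_apply a x) y = cinner x z" for x
  proof (induction x rule: basis_induct)
    case (5 j)
    have "(\<lambda>i. cinner (e j) (c i *\<^sub>C e i)) sums cinner (e j) z"
      by (rule bounded_linear.sums[OF cinner.bounded_linear_right z])
    moreover have "(\<lambda>i. cinner (e j) (c i *\<^sub>C e i)) = (\<lambda>i. if i = j then cnj (c i) else 0)"
      by (auto simp: cinner_scaleC_right cinner_basis)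
    ultimately have "cinner (e j) z = cnj (c j)"
      using sums_single[of j "\<lambda>i. cnj (c i)"] sums_unique2 by metis
    then show ?case
      by (metis c_def cinner_commute)
  qed (auto simp: blinfun.add_right cinner_add_left BH_scaleC[OF a] cinner_scaleC_left cinner_zero_left
      intro!: closed_Collect_eq cinner.continuous_on continuous_intros)
  then show ?thesis
    by blast
qed

text \<open>Uniqueness of the representing vectors makes \<open>f\<close> real-linear, and inserting
  \<open>x = f y\<close> bounds it. \<open>adj_eqI\<close> then identifies the resulting operator
  with \<open>adj a\<close>.\<close>

lemma cinner_adj:
  fixes a :: "'a \<Rightarrow>\<^sub>L 'a"
  assumes a: "a \<in> BH"
  shows "cinner (blinfun_apply a x) y = cinner x (blinfun_apply (adj a) y)"
proof -
  obtain f where f: "\<And>x y. cinner (blinfun_apply a x) y = cinner x (f y)"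
    using adjoint_vector[OF a] by metis
  have "bounded_linear f"
  proof (rule bounded_linear_intro)
    fix y z and r :: real
    show "f (y + z) = f y + f z"
      by (rule cinner_right_eqI) (simp add: f[symmetric] cinner_add_right)
    show "f (r *\<^sub>R y) = r *\<^sub>R f y"
      by (rule cinner_right_eqI) (simp add: f[symmetric] cinner_scaleR_right)
    have "(norm (f y))\<^sup>2 = cmod (cinner (blinfun_apply a (f y)) y)"
      by (simp add: f cinner_self norm_power)
    also have "\<dots> \<le> norm (blinfun_apply a (f y)) * norm y"
      by (rule norm_cinner_le)
    also have "\<dots> \<le> norm a * norm (f y) * norm y"
      by (intro mult_right_mono norm_blinfun norm_ge_zero)
    finally show "norm (f y) \<le> norm y * norm a"
      by (cases "f y = 0") (simp_all add: power2_eq_square mult_ac)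
  qed
  then have "adj a = Blinfun f"
    by (intro adj_eqI) (simp add: f bounded_linear_Blinfun_apply)
  then show ?thesis
    by (simp add: f bounded_linear_Blinfun_apply \<open>bounded_linear f\<close>)
qed

lemma BH_adj:
  fixes a :: "'a \<Rightarrow>\<^sub>L 'a"
  assumes "a \<in> BH"
  shows "adj a \<in> BH"
  unfolding BH_def mem_Collect_eq
  by (intro allI cinner_right_eqI) (simp add: cinner_adj[OF assms, symmetric] cinner_scaleC_right)

text \<open>Serves to carry adjoints over to norm limits in \<open>B_f_adj\<close>. Insert
  \<open>x = adj a y\<close> in the adjoint relation and cancel one factor of its norm.\<close>

lemma norm_adj_le:
  fixes a :: "'a \<Rightarrow>\<^sub>L 'a"
  assumes "a \<in> BH"
  shows "norm (adj a) \<le> norm a"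
proof (rule norm_blinfun_bound)
  fix y
  let ?z = "blinfun_apply (adj a) y"
  have "(norm ?z)\<^sup>2 = cmod (cinner (blinfun_apply a ?z) y)"
    by (simp add: cinner_adj[OF assms] cinner_self norm_power)
  also have "\<dots> \<le> norm (blinfun_apply a ?z) * norm y"
    by (rule norm_cinner_le)
  also have "\<dots> \<le> norm a * norm ?z * norm y"
    by (intro mult_right_mono norm_blinfun norm_ge_zero)
  finally show "norm ?z \<le> norm a * norm y"
    by (cases "?z = 0") (simp_all add: power2_eq_square mult_ac)
qed simp

lemma adj_diff:
  fixes a b :: "'a \<Rightarrow>\<^sub>L 'a"
  assumes "a \<in> BH" "b \<in> BH"
  shows "adj (a - b) = adj a - adj b"
  by (rule adj_eqI)
    (simp add: blinfun.diff_left cinner_diff_left cinner.diff_right cinner_adj[OF assms(1)]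
      cinner_adj[OF assms(2)])


section \<open>The algebra of operators approximable by sparse matrices\<close>

lemma B_kD:
  assumes "a \<in> B_k e k"
  shows "a \<in> BH" "finite {j. mat_entry e a i j \<noteq> 0}" "card {j. mat_entry e a i j \<noteq> 0} \<le> k"
    "finite {i. mat_entry e a i j \<noteq> 0}" "card {i. mat_entry e a i j \<noteq> 0} \<le> k"
  using assms by (auto simp: B_k_def)

text \<open>Enclosing a support in a small finite set suffices, so exact supports of sums and
  products never have to be computed.\<close>

lemma B_kI:
  assumes "a \<in> BH"
    "\<And>i. \<exists>F. finite F \<and> card F \<le> k \<and> {j. mat_entry e a i j \<noteq> 0} \<subseteq> F"
    "\<And>j. \<exists>F. finite F \<and> card F \<le> k \<and> {i. mat_entry e a i j \<noteq> 0} \<subseteq> F"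
  shows "a \<in> B_k e k"
proof -
  have "finite S \<and> card S \<le> k" if "\<exists>F. finite F \<and> card F \<le> k \<and> S \<subseteq> F" for S :: "nat set"
    using that by (meson card_mono finite_subset order_trans)
  from this[OF assms(2)] this[OF assms(3)] assms(1) show ?thesis
    unfolding B_k_def by blast
qed

lemma B_k_add:
  assumes a: "a \<in> B_k e k" and b: "b \<in> B_k e l"
  shows "a + b \<in> B_k e (k + l)"
proof (rule B_kI)
  have m: "mat_entry e (a + b) i j = mat_entry e a i j + mat_entry e b i j" for i j
    by (simp add: mat_entry_def blinfun.add_left cinner_add_left)
  show "a + b \<in> BH"
    using B_kD(1)[OF a] B_kD(1)[OF b] by (rule BH_add)
  fix i
  show "\<exists>F. finite F \<and> card F \<le> k + l \<and> {j. mat_entry e (a + b) i j \<noteq> 0} \<subseteq> F"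
    using B_kD(2,3)[OF a, of i] B_kD(2,3)[OF b, of i]
    by (intro exI[of _ "{j. mat_entry e a i j \<noteq> 0} \<union> {j. mat_entry e b i j \<noteq> 0}"])
      (auto simp: m intro: order_trans[OF card_Un_le] add_mono)
  show "\<exists>F. finite F \<and> card F \<le> k + l \<and> {j. mat_entry e (a + b) j i \<noteq> 0} \<subseteq> F"
    using B_kD(4,5)[OF a, of i] B_kD(4,5)[OF b, of i]
    by (intro exI[of _ "{j. mat_entry e a j i \<noteq> 0} \<union> {j. mat_entry e b j i \<noteq> 0}"])
      (auto simp: m intro: order_trans[OF card_Un_le] add_mono)
qed

text \<open>A finitely supported column makes \<open>b (e j)\<close> a finite combination of basis
  vectors, so the matrix product involves no infinite series.\<close>

lemma mat_entry_compose:
  assumes a: "a \<in> BH" and b: "finite {l. mat_entry e b l j \<noteq> 0}"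
  shows "mat_entry e (a o\<^sub>L b) i j =
    (\<Sum>l | mat_entry e b l j \<noteq> 0. mat_entry e b l j * mat_entry e a i l)"
proof -
  have "blinfun_apply b (e j) = (\<Sum>l | mat_entry e b l j \<noteq> 0. mat_entry e b l j *\<^sub>C e l)"
    unfolding mat_entry_def
    by (rule finite_expansion) (use b in \<open>auto simp: mat_entry_def\<close>)
  then show ?thesis
    unfolding mat_entry_def[of e "a o\<^sub>L b"] mat_entry_def[of e a]
    by (simp add: blinfun.sum_right BH_scaleC[OF a] cinner.sum_left cinner_scaleC_left)
qed

text \<open>A nonzero entry \<open>(i, j)\<close> of the product requires some \<open>m\<close> with
  \<open>(i, m)\<close> in the support of \<open>a\<close> and \<open>(m, j)\<close> in that of
  \<open>b\<close>. Such two-step paths from a fixed row or column have at most \<open>k * l\<close>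
  ends.\<close>

lemma B_k_compose:
  assumes a: "a \<in> B_k e k" and b: "b \<in> B_k e l"
  shows "a o\<^sub>L b \<in> B_k e (k * l)"
proof (rule B_kI)
  have UN: "finite (\<Union>x\<in>F. G x) \<and> card (\<Union>x\<in>F. G x) \<le> p * q"
    if F: "finite F" "card F \<le> p" and G: "\<And>x. finite (G x)" "\<And>x. card (G x) \<le> q"
    for F :: "nat set" and G :: "nat \<Rightarrow> nat set" and p q
  proof -
    have "card (\<Union>x\<in>F. G x) \<le> (\<Sum>x\<in>F. card (G x))"
      by (rule card_UN_le[OF F(1)])
    also have "\<dots> \<le> card F * q"
      using sum_bounded_above[of F "\<lambda>x. card (G x)" q] G(2) by simp
    also have "\<dots> \<le> p * q"
      using F(2) by simp
    finally show ?thesis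
      using F(1) G(1) by blast
  qed
  have nz: "\<exists>m. mat_entry e b m j \<noteq> 0 \<and> mat_entry e a i m \<noteq> 0"
    if "mat_entry e (a o\<^sub>L b) i j \<noteq> 0" for i j
  proof -
    have "(\<Sum>m | mat_entry e b m j \<noteq> 0. mat_entry e b m j * mat_entry e a i m) \<noteq> 0"
      using that mat_entry_compose[OF B_kD(1)[OF a] B_kD(4)[OF b]] by simp
    then obtain m where "mat_entry e b m j * mat_entry e a i m \<noteq> 0"
      by (meson sum.not_neutral_contains_not_neutral)
    then show ?thesis
      by auto
  qed
  show "a o\<^sub>L b \<in> BH"
    using B_kD(1)[OF a] B_kD(1)[OF b] by (rule BH_compose)
  fix i
  let ?R = "\<Union>m\<in>{m. mat_entry e a i m \<noteq> 0}. {j. mat_entry e b m j \<noteq> 0}"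
  have "finite ?R \<and> card ?R \<le> k * l"
    by (rule UN) (use B_kD[OF a] B_kD[OF b] in simp_all)
  moreover have "{j. mat_entry e (a o\<^sub>L b) i j \<noteq> 0} \<subseteq> ?R"
    using nz by blast
  ultimately show "\<exists>F. finite F \<and> card F \<le> k * l \<and> {j. mat_entry e (a o\<^sub>L b) i j \<noteq> 0} \<subseteq> F"
    by blast
  let ?C = "\<Union>m\<in>{m. mat_entry e b m i \<noteq> 0}. {j. mat_entry e a j m \<noteq> 0}"
  have "finite ?C \<and> card ?C \<le> l * k"
    by (rule UN) (use B_kD[OF a] B_kD[OF b] in simp_all)
  moreover have "{j. mat_entry e (a o\<^sub>L b) j i \<noteq> 0} \<subseteq> ?C"
    using nz by blast
  ultimately show "\<exists>F. finite F \<and> card F \<le> k * l \<and> {j. mat_entry e (a o\<^sub>L b) j i \<noteq> 0} \<subseteq> F"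
    by (metis mult.commute)
qed

lemma mat_entry_adj:
  assumes "a \<in> BH"
  shows "mat_entry e (adj a) i j = cnj (mat_entry e a j i)"
  unfolding mat_entry_def using cinner_adj[OF assms, of "e i" "e j"] by (metis cinner_commute)

lemma B_k_adj: "a \<in> B_k e k \<Longrightarrow> adj a \<in> B_k e k"
  by (simp add: B_k_def BH_adj mat_entry_adj)

text \<open>Covers 0 and the scalar multiples of the identity.\<close>

lemma B_k_diagonal:
  assumes "a \<in> BH" "\<And>i j. i \<noteq> j \<Longrightarrow> mat_entry e a i j = 0"
  shows "a \<in> B_k e 1"
proof (rule B_kI[OF assms(1)])
  fix i
  have "mat_entry e a i j = 0 \<and> mat_entry e a j i = 0" if "j \<noteq> i" for j
    using assms(2)[OF that] assms(2)[OF that[symmetric]] by (rule conjI[rotated])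
  then have "{j. mat_entry e a i j \<noteq> 0} \<subseteq> {i}" "{j. mat_entry e a j i \<noteq> 0} \<subseteq> {i}"
    by auto
  moreover have "finite {i}" "card {i} \<le> 1"
    by auto
  ultimately show "\<exists>F. finite F \<and> card F \<le> 1 \<and> {j. mat_entry e a i j \<noteq> 0} \<subseteq> F"
    "\<exists>F. finite F \<and> card F \<le> 1 \<and> {j. mat_entry e a j i \<noteq> 0} \<subseteq> F"
    by blast+
qed

section \<open>The norm closure of the sparse matrices as a C*-algebra\<close>

lemma B_k_imp_B_f: "a \<in> B_k e k \<Longrightarrow> a \<in> B_f e"
  unfolding B_f_def B_inf_def by (meson UN_I UNIV_I closure_subset subsetD)

lemma B_f_subset_BH: "B_f e \<subseteq> BH"
  unfolding B_f_def by (rule closure_minimal[OF _ closed_BH]) (auto simp: B_inf_def B_k_def)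

lemma B_f_zero: "0 \<in> B_f e"
  by (rule B_k_imp_B_f, rule B_k_diagonal) (simp_all add: BH_zero mat_entry_def cinner_zero_left)

lemma B_f_limitE:
  assumes "a \<in> B_f e"
  obtains f k where "\<And>n. f n \<in> B_k e (k n)" "f \<longlonglongrightarrow> a"
  using assms unfolding B_f_def closure_sequential B_inf_def by (auto) metis

lemma B_f_limitI:
  assumes "\<And>n. f n \<in> B_f e" "f \<longlonglongrightarrow> a"
  shows "a \<in> B_f e"
  using closed_sequentially[of "B_f e" f a] assms by (simp add: B_f_def)

lemma B_f_add:
  assumes "a \<in> B_f e" "b \<in> B_f e"
  shows "a + b \<in> B_f e"
proof -
  obtain f k where f: "\<And>n. f n \<in> B_k e (k n)" "f \<longlonglongrightarrow> a" 
    using B_f_limitE[OF assms(1)] by blast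
  obtain g l where g: "\<And>n. g n \<in> B_k e (l n)" "g \<longlonglongrightarrow> b" 
    using B_f_limitE[OF assms(2)] by blast
  show ?thesis
    by (rule B_f_limitI[OF _ tendsto_add[OF f(2) g(2)]]) (rule B_k_imp_B_f[OF B_k_add[OF f(1) g(1)]])
qed

lemma B_f_compose:
  assumes "a \<in> B_f e" "b \<in> B_f e"
  shows "a o\<^sub>L b \<in> B_f e"
proof -
  obtain f k where f: "\<And>n. f n \<in> B_k e (k n)" "f \<longlonglongrightarrow> a" 
    using B_f_limitE[OF assms(1)] by blast
  obtain g l where g: "\<And>n. g n \<in> B_k e (l n)" "g \<longlonglongrightarrow> b" 
    using B_f_limitE[OF assms(2)] by blast
  show ?thesis
    by (rule B_f_limitI[OF _ bounded_bilinear.tendsto[OF bounded_bilinear_blinfun_compose f(2) g(2)]])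
      (rule B_k_imp_B_f[OF B_k_compose[OF f(1) g(1)]])
qed

lemma B_f_adj:
  assumes "a \<in> B_f e"
  shows "adj a \<in> B_f e"
proof -
  obtain f k where f: "\<And>n. f n \<in> B_k e (k n)" "f \<longlonglongrightarrow> a" 
    by (rule B_f_limitE[OF assms]) blast
  have a: "a \<in> BH"
    using assms B_f_subset_BH by blast
  have "(\<lambda>n. norm (f n - a)) \<longlonglongrightarrow> 0"
    using f(2) by (simp add: tendsto_norm_zero LIM_zero)
  moreover have "\<forall>n. norm (adj (f n) - adj a) \<le> norm (f n - a)"
    using norm_adj_le[OF BH_diff[OF B_kD(1)[OF f(1)] a]] B_kD(1)[OF f(1)] a
    by (simp add: adj_diff)
  ultimately have "(\<lambda>n. adj (f n) - adj a) \<longlonglongrightarrow> 0"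
    by (metis (mono_tags, lifting) Lim_null_comparison always_eventually)
  then have "(\<lambda>n. adj (f n)) \<longlonglongrightarrow> adj a"
    by (rule LIM_zero_cancel)
  then show ?thesis
    by (rule B_f_limitI[rotated]) (rule B_k_imp_B_f[OF B_k_adj[OF f(1)]])
qed

text \<open>Scaling is composition with a multiple of the identity, whose matrix is diagonal, so
  closure under products applies.\<close>

lemma B_f_scaleC_op:
  assumes "a \<in> B_f e"
  shows "scaleC_op c a \<in> B_f e"
proof -
  have "scaleC_op c id_blinfun \<in> B_f e"
    by (rule B_k_imp_B_f, rule B_k_diagonal)
      (simp_all add: BH_scaleC_op BH_id mat_entry_def scaleC_op.rep_eq cinner_scaleC_left cinner_basis)
  moreover have "scaleC_op c a = scaleC_op c id_blinfun o\<^sub>L a"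
    by (rule blinfun_eqI) (simp add: scaleC_op.rep_eq)
  ultimately show ?thesis
    using assms by (simp add: B_f_compose)
qed

lemma cstar_subalgebra_B_f: "cstar_subalgebra (B_f e)"
  unfolding cstar_subalgebra_def
  by (auto simp: B_f_zero B_f_add B_f_compose B_f_adj B_f_scaleC_op subsetD[OF B_f_subset_BH])
    (simp add: B_f_def)

text \<open>Entry \<open>(i, j)\<close> is \<open>cinner (e j) v * cinner u (e i)\<close>, so rows
  are supported in \<open>?V\<close> and columns in \<open>?U\<close>; the sum of the two sizes
  bounds either.\<close>

lemma B_f_rank_one:
  assumes "finite {i. cinner u (e i) \<noteq> 0}" "finite {i. cinner v (e i) \<noteq> 0}"
  shows "rank_one u v \<in> B_f e"
proof -
  let ?U = "{i. cinner u (e i) \<noteq> 0}" and ?V = "{i. cinner v (e i) \<noteq> 0}"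
  have "rank_one u v \<in> B_k e (card ?U + card ?V)"
  proof (rule B_kI[OF BH_rank_one])
    fix i
    show "\<exists>F. finite F \<and> card F \<le> card ?U + card ?V \<and> {j. mat_entry e (rank_one u v) i j \<noteq> 0} \<subseteq> F"
      using assms cinner_eq_zero_commute
      by (intro exI[of _ ?V]) (auto simp: mat_entry_def rank_one.rep_eq cinner_scaleC_left)
    show "\<exists>F. finite F \<and> card F \<le> card ?U + card ?V \<and> {j. mat_entry e (rank_one u v) j i \<noteq> 0} \<subseteq> F"
      using assms
      by (intro exI[of _ ?U]) (auto simp: mat_entry_def rank_one.rep_eq cinner_scaleC_left)
  qed
  then show ?thesis
    by (rule B_k_imp_B_f)
qed

text \<open>The obstruction to membership in \<open>B_f\<close>. Take a \<open>k\<close>-sparse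
  \<open>y\<close> within \<open>\<epsilon>\<close> of \<open>x\<close> and let \<open>F\<close> be
  the support of its column \<open>j\<close>. Off \<open>F\<close> the entries of \<open>x\<close>
  are those of \<open>x - y\<close>, which Bessel bounds. The same \<open>k\<close> serves all
  columns.\<close>

lemma B_f_columns_sparse:
  assumes x: "x \<in> B_f e" and "\<epsilon> > 0"
  obtains k where "\<And>j. \<exists>F. finite F \<and> card F \<le> k \<and>
    (\<forall>G. finite G \<longrightarrow> G \<inter> F = {} \<longrightarrow> (\<Sum>i\<in>G. (cmod (mat_entry e x i j))\<^sup>2) \<le> \<epsilon>\<^sup>2)"
proof -
  obtain y k where y: "y \<in> B_k e k" and d: "dist y x < \<epsilon>"
    using assms unfolding B_f_def closure_approachable B_inf_def by blast
  show ?thesis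
  proof (rule that, intro exI conjI allI impI)
    fix j G
    let ?F = "{i. mat_entry e y i j \<noteq> 0}"
    show "finite ?F" "card ?F \<le> k"
      using B_kD[OF y] by auto
    assume G: "finite G" "G \<inter> ?F = {}"
    have "norm (e j) = 1"
      using Re_cinner_self[of "e j"] norm_ge_zero[of "e j"] by (auto simp: cinner_basis power2_eq_1_iff)
    have "(\<Sum>i\<in>G. (cmod (mat_entry e x i j))\<^sup>2) = (\<Sum>i\<in>G. (cmod (cinner (blinfun_apply (x - y) (e j)) (e i)))\<^sup>2)"
    proof (rule sum.cong)
      fix i assume "i \<in> G"
      then have "mat_entry e y i j = 0"
        using G(2) by blast
      then show "(cmod (mat_entry e x i j))\<^sup>2 = (cmod (cinner (blinfun_apply (x - y) (e j)) (e i)))\<^sup>2"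
        by (simp add: mat_entry_def blinfun.diff_left cinner_diff_left)
    qed simp
    also have "\<dots> \<le> (norm (blinfun_apply (x - y) (e j)))\<^sup>2"
      by (rule bessel[OF G(1)])
    also have "\<dots> \<le> \<epsilon>\<^sup>2"
      using norm_blinfun[of "x - y" "e j"] d \<open>norm (e j) = 1\<close>
      by (intro power_mono) (auto simp: dist_norm norm_minus_commute)
    finally show "(\<Sum>i\<in>G. (cmod (mat_entry e x i j))\<^sup>2) \<le> \<epsilon>\<^sup>2" .
  qed
qed


section \<open>The counterexample\<close>

text \<open>The pairing function splits the basis into infinitely many disjoint infinite families,
  so vectors built from different \<open>n\<close> have disjoint supports.\<close>

definition block :: "nat \<Rightarrow> nat \<Rightarrow> 'a" where
  "block n i = e (prod_encode (n, i))"

definition spread_coeff :: "nat \<Rightarrow> nat \<Rightarrow> real" where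
  "spread_coeff n i = (if i = 0 then 1 else 1 / real (n + 1))"

text \<open>Half of the squared norm 2 of \<open>spread n\<close> sits at the single basis vector \<open>block n 0\<close>, the other
  half is distributed evenly over \<open>(n + 1)\<^sup>2\<close> basis vectors.\<close>

definition spread :: "nat \<Rightarrow> 'a" where
  "spread n = (\<Sum>i\<le>(n + 1)\<^sup>2. spread_coeff n i *\<^sub>R block n i)"

text \<open>The part of \<open>block n i\<close> orthogonal to \<open>spread n\<close>; the divisor
  2 is the squared norm of \<open>spread n\<close>.\<close>

definition rest :: "nat \<Rightarrow> nat \<Rightarrow> 'a" where
  "rest n i = block n i - (cinner (block n i) (spread n) / 2) *\<^sub>C spread n"

lemma block_decode: "e k = block (fst (prod_decode k)) (snd (prod_decode k))"
  by (simp add: block_def)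

lemma cinner_block: "cinner (block m i) (block n j) = (if m = n \<and> i = j then 1 else 0)"
  by (auto simp: block_def cinner_basis)

lemma cinner_block_spread:
  "cinner (block m i) (spread n) =
    (if m = n \<and> i \<le> (n + 1)\<^sup>2 then complex_of_real (spread_coeff n i) else 0)"
  by (cases "m = n")
    (simp_all add: spread_def cinner.sum_right cinner_scaleR_right cinner_block scaleR_conv_of_real
      if_distrib cong: if_cong)

lemma cinner_spread_spread: "cinner (spread m) (spread n) = (if m = n then 2 else 0)"
proof -
  have "cinner (spread m) (spread n) =
      (\<Sum>i\<le>(m + 1)\<^sup>2. spread_coeff m i *\<^sub>R cinner (block m i) (spread n))"
    by (simp add: spread_def[of m] cinner.sum_left cinner_scaleR_left)
  also have "\<dots> = (if m = n then complex_of_real (\<Sum>i\<le>(n + 1)\<^sup>2. (spread_coeff n i)\<^sup>2) else 0)"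
    by (auto simp: cinner_block_spread scaleR_conv_of_real power2_eq_square)
  \<comment> \<open>Index 0 contributes 1, and the other (n + 1)^2 indices contribute 1 / (n + 1)^2
    each.\<close>
  also have "(\<Sum>i\<le>(n + 1)\<^sup>2. (spread_coeff n i)\<^sup>2) = 2"
    by (subst sum.atMost_shift) (simp add: spread_coeff_def power_divide)
  finally show ?thesis
    by simp
qed

lemma cinner_rest_spread: "cinner (rest m i) (spread n) = 0"
  by (simp add: rest_def cinner_diff_left cinner_scaleC_left cinner_spread_spread cinner_block_spread)

text \<open>Every basis vector is recovered from \<open>spread\<close> and \<open>rest\<close>
  vectors, so an operator in \<open>BH\<close> is determined by its values on these.\<close>

lemma block_eq_rest: "block n i = rest n i + (cinner (block n i) (spread n) / 2) *\<^sub>C spread n"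
  by (simp add: rest_def)

lemma finite_support_block: "finite {k. cinner (block n i) (e k) \<noteq> 0}"
  by (rule finite_subset[of _ "{prod_encode (n, i)}"]) (auto simp: block_def cinner_basis)

lemma finite_support_add:
  assumes "finite {k. cinner x (e k) \<noteq> 0}" "finite {k. cinner y (e k) \<noteq> 0}"
  shows "finite {k. cinner (x + y) (e k) \<noteq> 0}"
  by (rule finite_subset[OF _ finite_UnI[OF assms]]) (auto simp: cinner_add_left)

lemma finite_support_scaleC:
  assumes "finite {k. cinner x (e k) \<noteq> 0}"
  shows "finite {k. cinner (c *\<^sub>C x) (e k) \<noteq> 0}"
  by (rule finite_subset[OF _ assms]) (auto simp: cinner_scaleC_left)

lemma finite_support_spread: "finite {k. cinner (spread n) (e k) \<noteq> 0}"
proof (rule finite_subset)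
  show "{k. cinner (spread n) (e k) \<noteq> 0} \<subseteq> (\<lambda>i. prod_encode (n, i)) ` {..(n + 1)\<^sup>2}"
  proof
    fix k assume "k \<in> {k. cinner (spread n) (e k) \<noteq> 0}"
    then have "cinner (e k) (spread n) \<noteq> 0"
      using cinner_eq_zero_commute by blast
    then have "fst (prod_decode k) = n" "snd (prod_decode k) \<le> (n + 1)\<^sup>2"
      unfolding block_decode[of k] cinner_block_spread by (auto split: if_splits)
    then show "k \<in> (\<lambda>i. prod_encode (n, i)) ` {..(n + 1)\<^sup>2}"
      by (metis atMost_iff image_eqI prod.collapse prod_decode_inverse)
  qed
qed simp

lemma finite_support_rest: "finite {k. cinner (rest n i) (e k) \<noteq> 0}"
  using finite_support_add[OF finite_support_block finite_support_scaleC[OF finite_support_spread]]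
  unfolding rest_def diff_conv_add_uminus scaleC.scale_minus_left[symmetric] .

text \<open>Such an \<open>x\<close> maps \<open>block n 0\<close> to \<open>spread n / 2\<close>, so its columns are not uniformly sparse.\<close>

lemma spread_projection_notin_B_f:
  assumes x: "x \<in> B_f e" and spread: "\<And>n. blinfun_apply x (spread n) = spread n"
    and rest: "\<And>n. blinfun_apply x (rest n 0) = 0"
  shows False
proof -
  have BH: "x \<in> BH"
    using x B_f_subset_BH by blast
  \<comment> \<open>The evenly spread entries of the column considered below have squared mass 1/4
    in total. With tolerance 1/4, mass at most 1/16 may lie outside \<open>F\<close>.\<close>
  obtain k where k: "\<And>j. \<exists>F. finite F \<and> card F \<le> k \<and>
      (\<forall>G. finite G \<longrightarrow> G \<inter> F = {} \<longrightarrow> (\<Sum>i\<in>G. (cmod (mat_entry e x i j))\<^sup>2) \<le> (1 / 4)\<^sup>2)"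
    using B_f_columns_sparse[OF x, of "1 / 4"] by auto
  \<comment> \<open>The sparsity bound \<open>k\<close> itself selects the block: its (k + 1)^2
    equal entries outnumber the at most \<open>k\<close> rows in \<open>F\<close>.\<close>
  let ?j = "prod_encode (k, 0)"
  obtain F where F: "finite F" "card F \<le> k"
    and small: "\<And>G. finite G \<Longrightarrow> G \<inter> F = {} \<Longrightarrow> (\<Sum>i\<in>G. (cmod (mat_entry e x i ?j))\<^sup>2) \<le> (1 / 4)\<^sup>2"
    using k[of ?j] by blast
  have "blinfun_apply x (block k 0) = (1 / 2) *\<^sub>C spread k"
    by (subst block_eq_rest)
      (simp add: blinfun.add_right rest BH_scaleC[OF BH] spread cinner_block_spread spread_coeff_def)
  then have entry: "mat_entry e x (prod_encode (k, i)) ?j = complex_of_real (1 / (2 * real (k + 1)))"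
    if "i \<in> {1..(k + 1)\<^sup>2}" for i
    using that cinner_commute[of "spread k" "block k i"]
    by (simp add: mat_entry_def block_def[symmetric] cinner_scaleC_left cinner_block_spread spread_coeff_def)
  \<comment> \<open>Index 0 is the concentrated coordinate and is left out; only the evenly spread
    ones are collected.\<close>
  define A where "A = (\<lambda>i. prod_encode (k, i)) ` {1..(k + 1)\<^sup>2}"
  define d where "d = (k + 1)\<^sup>2 - k"
  have "card A = (k + 1)\<^sup>2"
    unfolding A_def by (subst card_image) (auto simp: inj_on_def)
  then have card: "d \<le> card (A - F)"
    using diff_card_le_card_Diff[OF F(1), of A] F(2) unfolding d_def by linarith
  have "real d / (4 * (real (k + 1))\<^sup>2) \<le> real (card (A - F)) / (4 * (real (k + 1))\<^sup>2)"
    using card by (intro divide_right_mono) auto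
  also have "\<dots> = (\<Sum>i\<in>A - F. (1 / (2 * real (k + 1)))\<^sup>2)"
    by (simp add: field_simps power2_eq_square)
  also have "\<dots> = (\<Sum>i\<in>A - F. (cmod (mat_entry e x i ?j))\<^sup>2)"
  proof (rule sum.cong)
    fix i assume "i \<in> A - F"
    then have "mat_entry e x i ?j = complex_of_real (1 / (2 * real (k + 1)))"
      using entry by (auto simp: A_def)
    then show "(1 / (2 * real (k + 1)))\<^sup>2 = (cmod (mat_entry e x i ?j))\<^sup>2"
      by (simp only: norm_of_real power2_abs)
  qed simp
  also have "\<dots> \<le> (1 / 4)\<^sup>2"
    by (rule small) (auto simp: A_def)
  finally have "real d \<le> (1 / 4)\<^sup>2 * (4 * (real (k + 1))\<^sup>2)"
    by (rule pos_divide_le_eq[THEN iffD1, rotated]) simp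
  then have "4 * real d \<le> (real (k + 1))\<^sup>2"
    by (simp add: power2_eq_square[of "1 / 4 :: real"])
  then have "real (4 * d) \<le> real ((k + 1)\<^sup>2)"
    by simp
  then have "4 * d \<le> (k + 1)\<^sup>2"
    by (simp only: of_nat_le_iff)
  \<comment> \<open>The first inequality makes the truncated subtraction in \<open>d\<close> exact;
    with the second, \<open>4 * d\<close> exceeds (k + 1)^2.\<close>
  moreover have "k \<le> (k + 1)\<^sup>2" "2 * k < (k + 1)\<^sup>2"
    by (simp_all add: power2_eq_square)
  ultimately show False
    unfolding d_def by linarith
qed

section \<open>A positive operator in \<open>B_f\<close> and its square root\<close>

definition weighted :: "'a \<Rightarrow>\<^sub>L 'a" where
  "weighted = (\<Sum>n. (1 / 2) ^ (n + 1) *\<^sub>R rank_one (spread n) (spread n))"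

text \<open>The rank-one operators have norm at most 2, so the geometric weights give absolute
  convergence in operator norm, the topology in which \<open>B_f\<close> is closed.\<close>

lemma weighted_sums:
  "(\<lambda>n. (1 / 2) ^ (n + 1) *\<^sub>R rank_one (spread n) (spread n)) sums weighted"
  unfolding weighted_def
proof (rule summable_sums, rule summable_comparison_test)
  have "norm (rank_one (spread n) (spread n)) \<le> 2" for n
    using norm_rank_one[of "spread n" "spread n"] Re_cinner_self[of "spread n"]
    by (simp add: cinner_spread_spread power2_eq_square)
  then have "norm ((1 / 2) ^ (n + 1) *\<^sub>R rank_one (spread n) (spread n)) \<le> (1 / 2) ^ n" for n
    by (simp add: power_add divide_simps)
  then show "\<exists>N. \<forall>n\<ge>N. norm ((1 / 2) ^ (n + 1) *\<^sub>R rank_one (spread n) (spread n)) \<le> (1 / 2) ^ n"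
    by blast
qed (simp add: summable_geometric)

lemma weighted_apply_sums:
  "(\<lambda>n. (1 / 2) ^ (n + 1) *\<^sub>R cinner x (spread n) *\<^sub>C spread n) sums blinfun_apply weighted x"
proof -
  have "(\<lambda>n. blinfun_apply ((1 / 2) ^ (n + 1) *\<^sub>R rank_one (spread n) (spread n)) x)
      sums blinfun_apply weighted x"
    by (rule bounded_linear.sums[OF _ weighted_sums]) (rule blinfun.bounded_linear_left)
  then show ?thesis
    by (simp add: blinfun.scaleR_left rank_one.rep_eq)
qed

lemma weighted_in_B_f: "weighted \<in> B_f e"
proof (rule B_f_limitI)
  show "(\<lambda>N. \<Sum>n<N. (1 / 2) ^ (n + 1) *\<^sub>R rank_one (spread n) (spread n)) \<longlonglongrightarrow> weighted"
    using weighted_sums by (simp only: sums_def)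
  have "r *\<^sub>R rank_one (spread n) (spread n) \<in> B_f e" for r n
  proof -
    have "r *\<^sub>R rank_one (spread n) (spread n) = scaleC_op (complex_of_real r) (rank_one (spread n) (spread n))"
      by (rule blinfun_eqI) (simp add: scaleC_op.rep_eq blinfun.scaleR_left scaleR_scaleC)
    then show ?thesis
      by (simp add: B_f_scaleC_op B_f_rank_one finite_support_spread)
  qed
  then show "(\<Sum>n<N. (1 / 2) ^ (n + 1) *\<^sub>R rank_one (spread n) (spread n)) \<in> B_f e" for N
    by (induction N) (simp_all add: B_f_zero B_f_add)
qed

lemma weighted_BH: "weighted \<in> BH"
  using weighted_in_B_f B_f_subset_BH by blast

lemma cinner_weighted_left_sums:
  "(\<lambda>n. (1 / 2) ^ (n + 1) *\<^sub>R (cinner x (spread n) * cinner (spread n) y))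
    sums cinner (blinfun_apply weighted x) y"
  using bounded_linear.sums[OF cinner.bounded_linear_left weighted_apply_sums[of x], of y]
  by (simp add: cinner_scaleR_left cinner_scaleC_left)

lemma adj_weighted: "adj weighted = weighted"
proof (rule adj_eqI)
  fix x y
  have "(\<lambda>n. (1 / 2) ^ (n + 1) *\<^sub>R (cnj (cinner y (spread n)) * cinner x (spread n)))
      sums cinner x (blinfun_apply weighted y)"
    using bounded_linear.sums[OF cinner.bounded_linear_right weighted_apply_sums[of y], of x]
    by (simp add: cinner_scaleR_right cinner_scaleC_right)
  then have "(\<lambda>n. (1 / 2) ^ (n + 1) *\<^sub>R (cinner x (spread n) * cinner (spread n) y))
      sums cinner x (blinfun_apply weighted y)"
    by (simp only: mult.commute[of "cinner x _"] cinner_commute[of "spread _" y])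
  then show "cinner (blinfun_apply weighted x) y = cinner x (blinfun_apply weighted y)"
    using cinner_weighted_left_sums sums_unique2 by blast
qed

text \<open>Only the term \<open>n = m\<close> survives. The squared norm 2 of
  \<open>spread m\<close> absorbs one factor 1/2, leaving exponent \<open>m\<close> instead of
  \<open>m + 1\<close>.\<close>

lemma weighted_spread: "blinfun_apply weighted (spread m) = (1 / 2) ^ m *\<^sub>R spread m"
proof -
  have "(\<lambda>n. (1 / 2) ^ (n + 1) *\<^sub>R cinner (spread m) (spread n) *\<^sub>C spread n)
      = (\<lambda>n. if n = m then (1 / 2) ^ n *\<^sub>R spread n else 0)"
    by (auto simp: cinner_spread_spread scaleR_scaleC scaleC_scaleC)
  then show ?thesis
    using weighted_apply_sums[of "spread m"] sums_single[of m "\<lambda>n. (1 / 2) ^ n *\<^sub>R spread n"]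
    by (simp add: sums_unique2)
qed

lemma weighted_rest: "blinfun_apply weighted (rest m i) = 0"
  using weighted_apply_sums[of "rest m i"] sums_unique2[OF _ sums_zero]
  by (simp add: cinner_rest_spread)

lemma positive_op_weighted: "positive_op weighted"
  unfolding positive_op_def
proof (intro conjI allI)
  fix x
  have s: "(\<lambda>n. complex_of_real ((1 / 2) ^ (n + 1) * (cmod (cinner x (spread n)))\<^sup>2))
      sums cinner (blinfun_apply weighted x) x"
    using cinner_weighted_left_sums[of x x] cinner_commute[of "spread _" x]
    by (simp add: scaleR_conv_of_real complex_norm_square[symmetric])
  have "(\<lambda>n. 0 :: real) sums Im (cinner (blinfun_apply weighted x) x)"
    using bounded_linear.sums[OF bounded_linear_Im s] by simp
  then have "Im (cinner (blinfun_apply weighted x) x) = 0"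
    using sums_unique2 sums_zero by blast
  then show "cinner (blinfun_apply weighted x) x \<in> \<real>"
    by (simp add: complex_is_Real_iff)
  show "0 \<le> Re (cinner (blinfun_apply weighted x) x)"
    by (rule sums_le[OF _ sums_zero bounded_linear.sums[OF bounded_linear_Re s]]) simp
qed (rule weighted_BH)

text \<open>The definite description in \<open>sqrt_op\<close> calls for uniqueness of the positive
  root. Any such \<open>p\<close> kills the \<open>rest\<close> vectors and has each
  \<open>spread n\<close> as eigenvector for \<open>(1 / 2) ^ n\<close>, hence agrees with
  \<open>weighted\<close> on the basis.\<close>

lemma sqrt_op_weighted: "sqrt_op (adj weighted o\<^sub>L weighted) = weighted"
  unfolding sqrt_op_def adj_weighted
proof (rule the_equality)
  fix p assume p: "positive_op p \<and> p o\<^sub>L p = weighted o\<^sub>L weighted"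
  then have pp: "blinfun_apply p (blinfun_apply p x) = blinfun_apply weighted (blinfun_apply weighted x)" for x
    by (metis blinfun_apply_blinfun_compose)
  have pos: "positive_op p" and BH: "p \<in> BH"
    using p by (simp_all add: positive_op_def)
  have rest: "blinfun_apply p (rest n i) = 0" for n i
    by (rule positive_op_kernel[OF pos]) (simp add: pp weighted_rest)
  have spread: "blinfun_apply p (spread n) = (1 / 2) ^ n *\<^sub>R spread n" for n
    by (rule positive_op_eigenvector[OF pos])
      (simp_all add: pp weighted_spread blinfun.scaleR_right power2_eq_square)
  show "p = weighted"
  proof (rule BH_eqI[OF BH weighted_BH])
    fix k
    show "blinfun_apply p (e k) = blinfun_apply weighted (e k)"
      unfolding block_decode[of k]
      by (subst (1 2) block_eq_rest)
        (simp add: blinfun.add_right BH_scaleC[OF BH] BH_scaleC[OF weighted_BH] rest spread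
          weighted_rest weighted_spread)
  qed
qed (simp add: positive_op_weighted)

text \<open>The factorization makes \<open>w\<close> fix the range of \<open>weighted\<close>, which
  contains every \<open>spread n\<close> up to a nonzero scalar; equality of kernels makes it vanish
  on \<open>rest n 0\<close>.\<close>

lemma weighted_no_polar:
  assumes "w \<in> B_f e" "weighted = w o\<^sub>L weighted" "ker_op w = ker_op weighted"
  shows False
proof (rule spread_projection_notin_B_f[OF assms(1)])
  fix n
  have "blinfun_apply w (blinfun_apply weighted (spread n)) = blinfun_apply weighted (spread n)"
    by (metis assms(2) blinfun_apply_blinfun_compose)
  then show "blinfun_apply w (spread n) = spread n"
    by (simp add: weighted_spread blinfun.scaleR_right)
  have "rest n 0 \<in> ker_op weighted"
    by (simp add: ker_op_def weighted_rest)
  then show "blinfun_apply w (rest n 0) = 0"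
    unfolding assms(3)[symmetric] by (simp add: ker_op_def)
qed

text \<open>Rank-one operators with range spanned by \<open>spread n\<close> lie in the right
  annihilator of \<open>S\<close>, so its generator \<open>q\<close> fixes \<open>spread n\<close>.
  Rank-one operators with functional given by \<open>rest n 0\<close> lie in \<open>S\<close>, so
  \<open>q\<close> kills \<open>rest n 0\<close>.\<close>

lemma not_AW_star_algebra_B_f: "\<not> AW_star_algebra (B_f e)"
proof
  assume AW: "AW_star_algebra (B_f e)"
  define S where "S = {s \<in> B_f e. \<forall>n. blinfun_apply s (spread n) = 0}"
  have "S \<subseteq> B_f e"
    by (auto simp: S_def)
  then obtain q where q: "q \<in> B_f e" "projection q"
    and ann: "{x \<in> B_f e. \<forall>s\<in>S. s o\<^sub>L x = 0} = (\<lambda>x. q o\<^sub>L x) ` B_f e"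
    using AW unfolding AW_star_algebra_def by blast
  have BH: "q \<in> BH" and adj: "adj q = q" and qq: "q o\<^sub>L q = q"
    using q(2) by (simp_all add: projection_def)
  have fin_e: "finite {i. cinner (e 0) (e i) \<noteq> 0}"
    by (simp add: cinner_basis)
  show False
  proof (rule spread_projection_notin_B_f[OF q(1)])
    fix n
    let ?r = "rank_one (spread n) (e 0)"
    have "?r \<in> B_f e"
      by (intro B_f_rank_one finite_support_spread fin_e)
    moreover have "s o\<^sub>L ?r = 0" if "s \<in> S" for s
      by (rule blinfun_eqI)
        (use that B_f_subset_BH in \<open>auto simp: S_def rank_one.rep_eq BH_scaleC\<close>)
    ultimately obtain y where "?r = q o\<^sub>L y"
      using ann by blast
    then have "blinfun_apply q (blinfun_apply ?r (e 0)) = blinfun_apply ?r (e 0)"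
      by (metis blinfun_apply_blinfun_compose qq)
    then show "blinfun_apply q (spread n) = spread n"
      by (simp add: rank_one.rep_eq cinner_basis scaleC_one)
    let ?s = "rank_one (e 0) (rest n 0)"
    have "?s \<in> B_f e"
      by (intro B_f_rank_one finite_support_rest fin_e)
    moreover have "cinner (spread m) (rest n 0) = 0" for m
      using cinner_rest_spread cinner_eq_zero_commute by blast
    ultimately have "?s \<in> S"
      by (simp add: S_def rank_one.rep_eq)
    \<comment> \<open>Idempotence puts \<open>q\<close> itself into the set that it generates, hence
      into the annihilator.\<close>
    moreover have "q \<in> {x \<in> B_f e. \<forall>s\<in>S. s o\<^sub>L x = 0}"
      unfolding ann by (rule image_eqI[OF _ q(1)]) (simp add: qq)
    ultimately have "?s o\<^sub>L q = 0"
      by blast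
    then have "cinner (blinfun_apply q z) (rest n 0) *\<^sub>C e 0 = 0" for z
      by (metis blinfun_apply_blinfun_compose rank_one.rep_eq zero_blinfun.rep_eq)
    then have "cinner (cinner (blinfun_apply q z) (rest n 0) *\<^sub>C e 0) (e 0) = 0" for z
      by (simp add: cinner_zero_left)
    then have "cinner (blinfun_apply q z) (rest n 0) = 0" for z
      by (simp add: cinner_scaleC_left cinner_basis)
    \<comment> \<open>The range of \<open>q\<close> is orthogonal to \<open>rest n 0\<close>;
      self-adjointness moves \<open>q\<close> to the other argument.\<close>
    then show "blinfun_apply q (rest n 0) = 0"
      by (intro cinner_right_eqI) (simp add: cinner.zero_right cinner_adj[OF BH] adj)
  qed
qed

end

theorem lemma7p1:
  fixes e :: "nat \<Rightarrow> 'a::complex_hilbert"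
  assumes "orthonormal_basis e"
  shows "cstar_subalgebra (B_f e) \<and>
    (\<exists>a\<in>B_f e. \<not> (\<exists>w\<in>B_f e. partial_isometry w \<and>
        a = w o\<^sub>L sqrt_op (adj a o\<^sub>L a) \<and> ker_op w = ker_op a)) \<and>
    \<not> AW_star_algebra (B_f e)"
proof -
  interpret hilbert_basis e
    using assms by unfold_locales
  show ?thesis
    using cstar_subalgebra_B_f not_AW_star_algebra_B_f weighted_no_polar
    by (auto simp: sqrt_op_weighted intro!: bexI[OF _ weighted_in_B_f])
qed

end
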